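(* Let $X_0, X_1, X_2, \ldots$ be a sequence of independent, identically distributed real-valued random variables whose common distribution is continuous. For $n \ge 1$ let $B_n = \vert \mathcal{R}_{n-1} \setminus \mathcal{R}_n \vert$ be the number of records broken at time $n$, where $\mathcal{R}_m$ denotes the set of Pareto optimal elements of $\{(i,X_i) : i = 0,\ldots,m\}$. Then the limiting distribution of $B_n$ as $n \to \infty$ is Geometric$(1/2)$, that is, for every $k = 0,1,2,\ldots$, $$ \lim_{n\to\infty} P[B_n = k] = \frac{1}{2^{k+1}}. $$
   Context: A distribution on $\mathbb{R}$ is continuous if its cumulative distribution function is continuous (equivalently, it has no atoms). Define a partial ordering on the pairs $(i,X_i)$, $i = 0,1,2,\ldots$, by $(i,X_i) \prec (j,X_j)$ if $i \le j$ and $X_i \le X_j$. For $n \ge 0$, the set $\mathcal{R}_n$ of Pareto optimal elements of $\{(i,X_i) : i=0,\ldots,n\}$ (the "current records at time $n$") consists of those pairs $(i,X_i)$ with $0 \le i \le n$ such that $(i,X_i) \not\prec (j,X_j)$ for all $0 \le j \le n$ with $j \ne i$. For $n \ge 1$, the set of records broken at time $n$ is $\mathcal{B}_n = \mathcal{R}_{n-1} \setminus \mathcal{R}_n$, and $B_n = \vert \mathcal{B}_n \vert$. *)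

theory Defs
  imports "HOL-Probability.Probability"
begin

definition prec :: "nat \<times> real \<Rightarrow> nat \<times> real \<Rightarrow> bool" (infix "\<prec>" 50) where
  "p \<prec> q \<longleftrightarrow> fst p \<le> fst q \<and> snd p \<le> snd q"

definition current_records :: "(nat \<Rightarrow> real) \<Rightarrow> nat \<Rightarrow> (nat \<times> real) set" where
  "current_records x n =
     {(i, x i) | i. i \<le> n \<and> (\<forall>j\<le>n. j \<noteq> i \<longrightarrow> \<not> (i, x i) \<prec> (j, x j))}"

(* Meaningful for n >= 1; at n = 0 truncated subtraction makes the set empty. *)
definition broken_records :: "(nat \<Rightarrow> real) \<Rightarrow> nat \<Rightarrow> (nat \<times> real) set" where
  "broken_records x n = current_records x (n - 1) - current_records x n"

definition num_broken :: "(nat \<Rightarrow> real) \<Rightarrow> nat \<Rightarrow> nat" where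
  "num_broken x n = card (broken_records x n)"

end

theory Submission
  imports Defs "HOL-Combinatorics.Stirling"
begin

text \<open>Read the sequence backwards from time \<open>n\<close>: with \<open>y i = X (n - i)\<close>, the records broken at time \<open>n\<close>
  are the strict left-to-right maxima of \<open>y 1, \<dots>, y n\<close> that are at most \<open>y 0\<close>. Let \<open>F\<close> be the common
  distribution function. The number of maxima of \<open>y 1, \<dots>, y m\<close> equals \<open>j\<close> with probability
  \<open>r m j = stirling m j / fact m\<close>, independently of the largest value, whose distribution
  function is \<open>F ^ m\<close>. Hence \<open>y (m + 1)\<close> is a new maximum, is at most \<open>y 0\<close>, and is preceded by exactly
  \<open>j\<close> maxima with probability \<open>d m j = r m j / ((m + 1) * (m + 2))\<close>, and with
  \<open>s n j = d 0 j + \<dots> + d (n - 1) j\<close> the probability of \<open>k\<close> broken records is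
  \<open>[k = 0] + s n (k - 1) - s n k\<close>. The recursion for the Stirling numbers telescopes to
  \<open>2 * s n k = [k = 0] + s n (k - 1) - r n k / (n + 1)\<close>, so that \<open>s n k\<close> tends to
  \<open>1 / 2 ^ (k + 1)\<close>.\<close>

text \<open>Independence enters as equality of the joint law with the product of the marginals. The
  product measure of a set is the integral of the measures of its fibers, and the fiber over
  \<open>u\<close> pulls back along \<open>V\<close> to the event
  \<open>P u (V \<omega>)\<close>.\<close>

lemma (in prob_space) prob_eq_integral_prob:
  assumes U[measurable]: "U \<in> measurable M S" and V[measurable]: "V \<in> measurable M T"
    and joint: "distr M S U \<Otimes>\<^sub>M distr M T V = distr M (S \<Otimes>\<^sub>M T) (\<lambda>\<omega>. (U \<omega>, V \<omega>))"
    and meas: "{z \<in> space (S \<Otimes>\<^sub>M T). P (fst z) (snd z)} \<in> sets (S \<Otimes>\<^sub>M T)"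
  shows "prob {\<omega> \<in> space M. P (U \<omega>) (V \<omega>)} = (\<integral>u. prob {\<omega> \<in> space M. P u (V \<omega>)} \<partial>distr M S U)"
proof -
  let ?A = "{z \<in> space (S \<Otimes>\<^sub>M T). P (fst z) (snd z)}"
  interpret U: prob_space "distr M S U" by (rule prob_space_distr) fact
  interpret V: prob_space "distr M T V" by (rule prob_space_distr) fact
  have A[measurable]: "?A \<in> sets (distr M S U \<Otimes>\<^sub>M distr M T V)"
    using meas by simp
  have fib: "V.prob (Pair u -` ?A) = prob {\<omega> \<in> space M. P u (V \<omega>)}" if "u \<in> space S" for u
  proof -
    have "Pair u -` ?A \<in> sets T"
      using meas by (rule sets_Pair1)
    then show ?thesis
      using that measurable_space[OF V]
      by (subst measure_distr) (auto simp: space_pair_measure intro!: arg_cong[where f=prob])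
  qed
  have "prob {\<omega> \<in> space M. P (U \<omega>) (V \<omega>)} = measure (distr M (S \<Otimes>\<^sub>M T) (\<lambda>\<omega>. (U \<omega>, V \<omega>))) ?A"
    using meas measurable_space[OF U] measurable_space[OF V]
    by (subst measure_distr) (auto simp: space_pair_measure intro!: arg_cong[where f=prob])
  also have "\<dots> = measure (distr M S U \<Otimes>\<^sub>M distr M T V) ?A"
    by (simp add: joint)
  also have "\<dots> = enn2real (\<integral>\<^sup>+u. emeasure (distr M T V) (Pair u -` ?A) \<partial>distr M S U)"
    by (simp add: measure_def V.emeasure_pair_measure_alt[OF A])
  also have "\<dots> = (\<integral>u. V.prob (Pair u -` ?A) \<partial>distr M S U)"
    unfolding V.emeasure_eq_measure
    by (rule integral_eq_nn_integral[symmetric])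
       (use V.measurable_emeasure_Pair[OF A] in \<open>simp_all add: measure_def\<close>)
  also have "\<dots> = (\<integral>u. prob {\<omega> \<in> space M. P u (V \<omega>)} \<partial>distr M S U)"
    by (intro Bochner_Integration.integral_cong) (simp_all add: fib del: vimage_Collect_eq)
  finally show ?thesis .
qed

section \<open>Powers of a distribution function without atoms\<close>

locale atomless_distribution = real_distribution +
  assumes atomless: "measure M {x} = 0"
begin

text \<open>The inequality is strict to match the events \<open>Y i < s\<close> below; by
  \<open>prob_atMost\<close> this is still the distribution function.\<close>

definition F :: "real \<Rightarrow> real" where
  "F s = measure M {..<s}"

lemma prob_atMost: "measure M {..s} = F s"
proof -
  have "measure M ({..<s} \<union> {s}) = measure M {..<s} + measure M {s}"
    by (rule finite_measure_Union) auto
  moreover have "{..<s} \<union> {s} = {..s}"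
    by auto
  ultimately show ?thesis
    by (simp add: F_def atomless)
qed

lemma F_nonneg [simp]: "0 \<le> F s"
  and F_le_1 [simp]: "F s \<le> 1"
  by (simp_all add: F_def)

lemma measurable_F [measurable]: "F \<in> borel_measurable borel"
  by (rule borel_measurable_mono) (auto simp: mono_def F_def intro!: finite_measure_mono)

lemma integrable_indicator_F:
  "S \<in> sets borel \<Longrightarrow> integrable M (\<lambda>t. indicator S t * F t ^ m)"
  by (rule integrable_const_bound[where B=1])
     (auto simp: power_le_one indicator_def)

text \<open>By Fubini and \<open>F r = measure M {..r}\<close>, writing \<open>I m\<close> for the integral of \<open>F ^ m\<close> over \<open>S\<close>,
  one gets \<open>I (m + 1) = (m + 1) * (measure M S * I m - I (m + 1))\<close>.\<close>
lemma integral_F_power: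
  assumes S: "S \<in> sets borel" and down: "\<And>s t. t \<in> S \<Longrightarrow> s \<le> t \<Longrightarrow> s \<in> S"
  shows "(\<integral>t. indicator S t * F t ^ m \<partial>M) = measure M S ^ Suc m / Suc m"
  using S down
proof (induction m arbitrary: S)
  case 0
  then show ?case by simp
next
  case (Suc m)
  note [measurable] = Suc.prems(1)
  interpret P: pair_prob_space M M ..
  let ?f = "\<lambda>t r. indicator S t * indicator {..<t} r * F r ^ m :: real"
  let ?I = "\<lambda>m. \<integral>t. indicator S t * F t ^ m \<partial>M"
  have int: "integrable (M \<Otimes>\<^sub>M M) (case_prod ?f)"
  proof (rule P.integrable_const_bound[where B=1])
    show "AE x in M \<Otimes>\<^sub>M M. norm (case_prod ?f x) \<le> 1"
      by (auto simp: indicator_def power_le_one)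
    have "case_prod ?f = (\<lambda>x. indicator S (fst x) * of_bool (snd x < fst x) * F (snd x) ^ m)"
      by (auto simp: indicator_def fun_eq_iff)
    then show "case_prod ?f \<in> borel_measurable (M \<Otimes>\<^sub>M M)"
      by simp
  qed
  \<comment> \<open>For \<open>r\<close> in the down-set \<open>S\<close>, removing
    \<open>{..r}\<close> leaves measure \<open>measure M S - F r\<close>; for \<open>r\<close>
    outside \<open>S\<close>, no element of \<open>S\<close> exceeds \<open>r\<close>.\<close>
  have fiber: "(\<integral>t. ?f t r \<partial>M) = indicator S r * (measure M S * F r ^ m - F r ^ Suc m)" for r
  proof (cases "r \<in> S")
    case True
    have "(\<integral>t. ?f t r \<partial>M) = (\<integral>t. indicator (S - {..r}) t * F r ^ m \<partial>M)"
      by (intro Bochner_Integration.integral_cong) (auto simp: indicator_def)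
    also have "\<dots> = measure M (S - {..r}) * F r ^ m"
      by simp
    also have "measure M (S - {..r}) = measure M S - F r"
      using Suc.prems(2)[OF True] by (subst finite_measure_Diff) (auto simp: prob_atMost)
    finally show ?thesis
      using True by (simp add: algebra_simps)
  next
    case False
    have "(\<integral>t. ?f t r \<partial>M) = (\<integral>t. 0 \<partial>M)"
      using False Suc.prems(2)[of _ r]
      by (intro Bochner_Integration.integral_cong) (auto simp: indicator_def dest: less_imp_le)
    then show ?thesis
      using False by simp
  qed
  \<comment> \<open>The induction hypothesis for the down-set \<open>{..<t}\<close>, whose measure
    is \<open>F t\<close>, turns \<open>F t ^ Suc m\<close> into an inner integral. After Fubini it
    is used again, for \<open>S\<close> itself.\<close>
  have "?I (Suc m) = (\<integral>t. real (Suc m) * (\<integral>r. ?f t r \<partial>M) \<partial>M)"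
  proof (intro Bochner_Integration.integral_cong refl)
    fix t
    have "(\<integral>r. indicator {..<t} r * F r ^ m \<partial>M) = F t ^ Suc m / real (Suc m)"
      by (subst Suc.IH) (auto simp: F_def)
    then show "indicator S t * F t ^ Suc m = real (Suc m) * (\<integral>r. ?f t r \<partial>M)"
      by (simp add: mult.assoc del: power_Suc of_nat_Suc)
  qed
  also have "\<dots> = real (Suc m) * (\<integral>t. (\<integral>r. ?f t r \<partial>M) \<partial>M)"
    by (rule integral_mult_right_zero)
  also have "(\<integral>t. (\<integral>r. ?f t r \<partial>M) \<partial>M) = (\<integral>r. (\<integral>t. ?f t r \<partial>M) \<partial>M)"
    by (rule P.Fubini_integral[OF int, symmetric])
  also have "\<dots> = (\<integral>r. measure M S * (indicator S r * F r ^ m) - indicator S r * F r ^ Suc m \<partial>M)"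
    unfolding fiber by (intro Bochner_Integration.integral_cong refl) (simp add: algebra_simps)
  also have "\<dots> = measure M S * ?I m - ?I (Suc m)"
    using integrable_indicator_F[OF Suc.prems(1), of m] integrable_indicator_F[OF Suc.prems(1), of "Suc m"]
    by (subst Bochner_Integration.integral_diff) (simp_all del: power_Suc)
  also have "?I m = measure M S ^ Suc m / Suc m"
    using Suc.prems by (rule Suc.IH)
  finally have eq: "?I (Suc m) = Suc m * (measure M S * (measure M S ^ Suc m / Suc m) - ?I (Suc m))" .
  have solve: "x = p * q / (c + 1)" if "x = c * (p * (q / c) - x)" "c > 0" for x c p q :: real
  proof -
    have "c * (p * (q / c)) = p * q"
      using that by simp
    then have "(c + 1) * x = p * q"
      using that(1) by (simp add: right_diff_distrib distrib_right)
    then show ?thesis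
      using that(2) by (simp add: eq_divide_eq mult.commute)
  qed
  have "real (Suc (Suc m)) = real (Suc m) + 1"
    by simp
  then show ?case
    using solve[OF eq] by (simp only: power_Suc of_nat_0_less_iff zero_less_Suc)
qed

end

subsection \<open>Left-to-right maxima\<close>

text \<open>In \<open>num_low_maxima\<close> the sequence is meant to be read backwards in time, \<open>y i = X (n - i)\<close>, so that
  \<open>y 0\<close> is the newest value, which breaks the records at most as large as itself; it is
  not a candidate for a maximum.\<close>

primrec num_maxima :: "(nat \<Rightarrow> real) \<Rightarrow> nat \<Rightarrow> nat" where
  "num_maxima y 0 = 0"
| "num_maxima y (Suc m) = num_maxima y m + of_bool (\<forall>i\<in>{1..m}. y i < y (Suc m))"

primrec num_low_maxima :: "(nat \<Rightarrow> real) \<Rightarrow> nat \<Rightarrow> nat" where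
  "num_low_maxima y 0 = 0"
| "num_low_maxima y (Suc m) =
     num_low_maxima y m + of_bool ((\<forall>i\<in>{1..m}. y i < y (Suc m)) \<and> y (Suc m) \<le> y 0)"

lemma num_maxima_cong:
  "(\<And>i. i \<in> {1..m} \<Longrightarrow> y i = z i) \<Longrightarrow> num_maxima y m = num_maxima z m"
  by (induction m) auto

text \<open>Meant for the event that \<open>y (Suc m)\<close> exceeds all earlier values and is at
  most \<open>y 0\<close>: the earlier values are then below \<open>y 0\<close> as well, so plain
  maxima can be counted.\<close>

lemma num_low_maxima_eq:
  "(\<And>i. i \<in> {1..m} \<Longrightarrow> y i \<le> y 0) \<Longrightarrow> num_low_maxima y m = num_maxima y m"
  by (induction m) auto

lemma measurable_num_maxima [measurable]:
  assumes "\<And>i. i \<in> {1..m} \<Longrightarrow> Y i \<in> borel_measurable M"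
  shows "(\<lambda>\<omega>. num_maxima (\<lambda>i. Y i \<omega>) m) \<in> measurable M (count_space UNIV)"
  using assms
proof (induction m)
  case (Suc m)
  then have [measurable]: "(\<lambda>\<omega>. num_maxima (\<lambda>i. Y i \<omega>) m) \<in> measurable M (count_space UNIV)"
    and [measurable]: "\<And>i. i \<in> {1..Suc m} \<Longrightarrow> Y i \<in> borel_measurable M"
    by auto
  have [measurable]: "Measurable.pred M (\<lambda>\<omega>. \<forall>i\<in>{1..m}. Y i \<omega> < Y (Suc m) \<omega>)"
    by (intro pred_intros_finite) auto
  show ?case
    by simp
qed simp

lemma measurable_num_low_maxima [measurable]:
  assumes "\<And>i. i \<in> {..m} \<Longrightarrow> Y i \<in> borel_measurable M"
  shows "(\<lambda>\<omega>. num_low_maxima (\<lambda>i. Y i \<omega>) m) \<in> measurable M (count_space UNIV)"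
  using assms
proof (induction m)
  case (Suc m)
  then have [measurable]: "(\<lambda>\<omega>. num_low_maxima (\<lambda>i. Y i \<omega>) m) \<in> measurable M (count_space UNIV)"
    and [measurable]: "\<And>i. i \<in> {..Suc m} \<Longrightarrow> Y i \<in> borel_measurable M"
    by auto
  have [measurable]: "Measurable.pred M (\<lambda>\<omega>. \<forall>i\<in>{1..m}. Y i \<omega> < Y (Suc m) \<omega>)"
    by (intro pred_intros_finite) auto
  show ?case
    by simp
qed simp

section \<open>The Stirling law of the number of maxima, and the limit of the sums\<close>

definition maxima_prob :: "nat \<Rightarrow> nat \<Rightarrow> real" where
  "maxima_prob m j = real (stirling m j) / fact m"

lemma maxima_prob_0: "maxima_prob 0 j = of_bool (j = 0)"
  by (cases j) (simp_all add: maxima_prob_def)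

text \<open>The recurrence of the unsigned Stirling numbers of the first kind, divided by
  \<open>fact (Suc m)\<close>. In probabilistic terms, the last of \<open>m + 1\<close> values is a
  maximum with probability \<open>1 / (m + 1)\<close>, independently of the number of earlier
  maxima.\<close>

lemma maxima_prob_Suc:
  "maxima_prob (Suc m) j =
     ((if j = 0 then 0 else maxima_prob m (j - 1)) + real m * maxima_prob m j) / real (Suc m)"
proof (cases j)
  case 0
  then show ?thesis by (cases m) (simp_all add: maxima_prob_def)
next
  case (Suc i)
  have "fact (Suc m) = real (Suc m) * fact m" by simp
  then show ?thesis
    by (simp add: Suc maxima_prob_def divide_simps del: of_nat_Suc)
qed

text \<open>A Stirling number is at most its row sum \<open>fact m\<close>. This crude bound
  suffices to make the error term in \<open>new_max_sum_eq\<close> vanish.\<close>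

lemma maxima_prob_bounds: "0 \<le> maxima_prob m j" "maxima_prob m j \<le> 1"
proof -
  show "0 \<le> maxima_prob m j" by (simp add: maxima_prob_def)
  have "stirling m j \<le> fact m"
  proof (cases "j \<le> m")
    case True
    then have "stirling m j \<le> (\<Sum>k\<le>m. stirling m k)"
      by (intro member_le_sum) auto
    then show ?thesis by (simp add: sum_stirling)
  qed simp
  then have "real (stirling m j) \<le> real (fact m)"
    by (simp only: of_nat_le_iff)
  then show "maxima_prob m j \<le> 1"
    by (simp add: maxima_prob_def)
qed

text \<open>The summands will be the probabilities of the disjoint events that the number of low
  maxima rises from \<open>k\<close> to \<open>k + 1\<close> at index \<open>m + 1\<close>. The sum
  is thus the probability of more than \<open>k\<close> low maxima, a tail whose limit is the
  geometric one.\<close>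

definition new_max_sum :: "nat \<Rightarrow> nat \<Rightarrow> real" where
  "new_max_sum n k = (\<Sum>m<n. maxima_prob m k / (real (Suc m) * real (Suc (Suc m))))"

lemma new_max_sum_eq:
  "2 * new_max_sum n k =
     of_bool (k = 0) + (if k = 0 then 0 else new_max_sum n (k - 1)) - maxima_prob n k / real (Suc n)"
proof (induction n)
  case 0
  then show ?case by (simp add: new_max_sum_def maxima_prob_0)
next
  case (Suc n)
  let ?prev = "if k = 0 then 0 else maxima_prob n (k - 1)"
  \<comment> \<open>Here \<open>a\<close> is \<open>n\<close>, \<open>r\<close> is
    \<open>maxima_prob n k\<close> and \<open>p\<close> is the value for \<open>k - 1\<close>. With
    \<open>e n = maxima_prob n k / (n + 1)\<close> the last two terms become
    \<open>e n - e (n + 1)\<close>, which telescopes; \<open>e 0\<close> is the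
    \<open>of_bool (k = 0)\<close> of the claim.\<close>
  have frac: "2 * (r / ((a + 1) * (a + 2))) = p / ((a + 1) * (a + 2)) - (p + a * r) / (a + 1) / (a + 2) + r / (a + 1)"
    if "a \<ge> 0" for a r p :: real
    using that by (simp add: divide_simps) (simp add: algebra_simps)
  have "2 * (maxima_prob n k / (real (Suc n) * real (Suc (Suc n)))) =
      ?prev / (real (Suc n) * real (Suc (Suc n)))
      - maxima_prob (Suc n) k / real (Suc (Suc n)) + maxima_prob n k / real (Suc n)"
    unfolding maxima_prob_Suc using frac[of "real n" "maxima_prob n k" ?prev] by (simp add: add.commute)
  then show ?case
    using Suc by (cases "k = 0") (simp_all add: new_max_sum_def algebra_simps)
qed

text \<open>By \<open>new_max_sum_eq\<close>, up to a vanishing error, each increase of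
  \<open>k\<close> halves the sum, and for \<open>k = 0\<close> the indicator gives
  \<open>1 / 2\<close>.\<close>

lemma tendsto_new_max_sum: "(\<lambda>n. new_max_sum n k) \<longlonglongrightarrow> 1 / 2 ^ Suc k"
proof (induction k)
  have e: "(\<lambda>n. maxima_prob n k / real (Suc n)) \<longlonglongrightarrow> 0" for k
  proof (rule tendsto_sandwich)
    show "(\<lambda>n. 0) \<longlonglongrightarrow> (0::real)" by simp
    show "(\<lambda>n. inverse (real (Suc n))) \<longlonglongrightarrow> 0" by (rule LIMSEQ_inverse_real_of_nat)
  qed (auto simp: maxima_prob_bounds divide_inverse mult_left_le_one_le simp del: of_nat_Suc intro!: always_eventually)
  {
    case 0
    have eq: "new_max_sum n 0 = (1 - maxima_prob n 0 / real (Suc n)) / 2" for n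
      using new_max_sum_eq[of n 0] by (simp del: of_nat_Suc)
    have "(\<lambda>n. (1 - maxima_prob n 0 / real (Suc n)) / 2) \<longlonglongrightarrow> (1 - 0) / 2"
      by (intro tendsto_intros e) simp
    then show ?case unfolding eq by simp
  next
    case (Suc k)
    have eq: "new_max_sum n (Suc k) = (new_max_sum n k - maxima_prob n (Suc k) / real (Suc n)) / 2" for n
      using new_max_sum_eq[of n "Suc k"] by (simp del: of_nat_Suc)
    have "(\<lambda>n. (new_max_sum n k - maxima_prob n (Suc k) / real (Suc n)) / 2)
        \<longlonglongrightarrow> (1 / 2 ^ Suc k - 0) / 2"
      by (intro tendsto_intros e Suc) simp
    then show ?case unfolding eq by simp
  }
qed

subsection \<open>Maxima of an i.i.d. sequence\<close>

text \<open>Independence is restricted to \<open>{..N}\<close> because the reversed sequence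
  \<open>X (n - i)\<close> repeats \<open>X 0\<close> for all \<open>i > n\<close>.\<close>

locale iid_atomless = prob_space M + D: atomless_distribution D
  for M :: "'a measure" and D +
  fixes Y :: "nat \<Rightarrow> 'a \<Rightarrow> real" and N :: nat
  assumes indep: "indep_vars (\<lambda>_. borel) Y {..N}"
    and distr_Y: "i \<le> N \<Longrightarrow> distr M borel (Y i) = D"
begin

lemma measurable_Y [measurable]: "i \<le> N \<Longrightarrow> Y i \<in> borel_measurable M"
  using indep by (auto simp: indep_vars_def)

text \<open>Conditioning on \<open>Y i\<close>, which is independent of the vector of the
  \<open>Y j\<close> with \<open>j\<close> in \<open>J\<close>. \<open>P\<close> takes that vector,
  so that measurability can be stated on a product space; \<open>Q\<close> is the same condition at
  the sample point.\<close>

lemma prob_eq_integral: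
  assumes "i \<le> N" "J \<subseteq> {..N}" "i \<notin> J"
    and "Measurable.pred (borel \<Otimes>\<^sub>M PiM J (\<lambda>_. borel)) (\<lambda>z. P (fst z) (snd z))"
    and P: "\<And>u \<omega>. P u (\<lambda>j\<in>J. Y j \<omega>) \<longleftrightarrow> Q u \<omega>"
  shows "prob {\<omega> \<in> space M. Q (Y i \<omega>) \<omega>} = (\<integral>u. prob {\<omega> \<in> space M. Q u \<omega>} \<partial>D)"
proof -
  have J: "Y j \<in> borel_measurable M" if "j \<in> J" for j
    using assms that by auto
  have i[measurable]: "Y i \<in> borel_measurable M"
    using assms by simp
  let ?V = "\<lambda>\<omega>. \<lambda>j\<in>J. Y j \<omega>" and ?T = "PiM J (\<lambda>_. borel :: real measure)"
  have V[measurable]: "?V \<in> measurable M ?T"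
    using J by (intro measurable_restrict)
  \<comment> \<open>Disjoint blocks of indices yield independent vectors; the one-element block is
    unwrapped to \<open>Y i\<close> in the proof of \<open>joint\<close>.\<close>
  have ind: "indep_var (PiM {i} (\<lambda>_. borel)) (\<lambda>\<omega>. \<lambda>j\<in>{i}. Y j \<omega>) ?T ?V"
    by (rule indep_var_restrict[OF indep]) (use assms in auto)
  interpret V: prob_space "distr M ?T ?V" by (rule prob_space_distr) fact
  have joint: "distr M borel (Y i) \<Otimes>\<^sub>M distr M ?T ?V = distr M (borel \<Otimes>\<^sub>M ?T) (\<lambda>\<omega>. (Y i \<omega>, ?V \<omega>))"
  proof (rule pair_measure_eqI)
    show "sigma_finite_measure (distr M borel (Y i))"
      unfolding distr_Y[OF assms(1)] by unfold_locales
    show "sigma_finite_measure (distr M ?T ?V)"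
      by unfold_locales
    fix A B assume "A \<in> sets (distr M borel (Y i))" "B \<in> sets (distr M ?T ?V)"
    then have A: "A \<in> sets borel" and B: "B \<in> sets ?T"
      by simp_all
    have "(\<lambda>f. f i) -` A \<inter> space (PiM {i} (\<lambda>_. borel)) \<in> sets (PiM {i} (\<lambda>_. borel :: real measure))"
      by (rule measurable_sets[OF _ A]) simp
    from indep_varD[OF ind this B]
    have "prob ((\<lambda>\<omega>. (Y i \<omega>, ?V \<omega>)) -` (A \<times> B) \<inter> space M) =
        prob (Y i -` A \<inter> space M) * prob (?V -` B \<inter> space M)"
      by (simp add: vimage_def space_PiM)
    then show "emeasure (distr M borel (Y i)) A * emeasure (distr M ?T ?V) B =
        emeasure (distr M (borel \<Otimes>\<^sub>M ?T) (\<lambda>\<omega>. (Y i \<omega>, ?V \<omega>))) (A \<times> B)"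
      using A B by (simp add: emeasure_distr emeasure_eq_measure ennreal_mult)
  qed simp
  show ?thesis
    using prob_eq_integral_prob[OF i V joint, of P] assms(4)
    by (simp add: P distr_Y[OF assms(1)] pred_def)
qed

text \<open>\<open>Y (Suc m)\<close> is integrated out. The threshold \<open>g\<close> covers two
  cases: the identity makes \<open>Y (Suc m)\<close> a new maximum, and a constant bounds the
  earlier values by a fixed number.\<close>

lemma prob_maxima_next:
  assumes m: "Suc m \<le> N" and S[measurable]: "S \<in> sets borel" and g[measurable]: "g \<in> borel_measurable borel"
    and p: "\<And>s. prob {\<omega> \<in> space M. num_maxima (\<lambda>i. Y i \<omega>) m = j \<and> (\<forall>i\<in>{1..m}. Y i \<omega> < s)} = p s"
  shows "prob {\<omega> \<in> space M. num_maxima (\<lambda>i. Y i \<omega>) m = j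
      \<and> (\<forall>i\<in>{1..m}. Y i \<omega> < g (Y (Suc m) \<omega>)) \<and> Y (Suc m) \<omega> \<in> S} =
    (\<integral>u. indicator S u * p (g u) \<partial>D)"
proof -
  let ?Q = "\<lambda>u \<omega>. num_maxima (\<lambda>i. Y i \<omega>) m = j \<and> (\<forall>i\<in>{1..m}. Y i \<omega> < g u) \<and> u \<in> S"
  have "prob {\<omega> \<in> space M. ?Q (Y (Suc m) \<omega>) \<omega>} = (\<integral>u. prob {\<omega> \<in> space M. ?Q u \<omega>} \<partial>D)"
  proof (rule prob_eq_integral[where J = "{1..m}"])
    let ?P = "\<lambda>u v. num_maxima v m = j \<and> (\<forall>i\<in>{1..m}. v i < g u) \<and> u \<in> S"
    show "?P u (\<lambda>j\<in>{1..m}. Y j \<omega>) \<longleftrightarrow> ?Q u \<omega>" for u \<omega>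
    proof -
      have "num_maxima (\<lambda>j\<in>{1..m}. Y j \<omega>) m = num_maxima (\<lambda>i. Y i \<omega>) m"
        by (rule num_maxima_cong) auto
      then show ?thesis by simp
    qed
    let ?N = "borel \<Otimes>\<^sub>M PiM {1..m} (\<lambda>_. borel) :: (real \<times> (nat \<Rightarrow> real)) measure"
    have comp[measurable]: "(\<lambda>z. snd z i) \<in> borel_measurable ?N" if "i \<in> {1..m}" for i
      using that by measurable
    have [measurable]: "(\<lambda>z. g (fst z)) \<in> borel_measurable ?N"
      by measurable
    have [measurable]: "Measurable.pred ?N (\<lambda>z. \<forall>i\<in>{1..m}. snd z i < g (fst z))"
      by (intro pred_intros_finite borel_measurable_pred_less comp) auto
    have [measurable]: "(\<lambda>z. num_maxima (\<lambda>i. snd z i) m) \<in> measurable ?N (count_space UNIV)"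
      by (rule measurable_num_maxima) (rule comp)
    show "Measurable.pred ?N (\<lambda>z. ?P (fst z) (snd z))"
      by measurable
  qed (use m in auto)
  also have "\<dots> = (\<integral>u. indicator S u * p (g u) \<partial>D)"
    by (intro Bochner_Integration.integral_cong) (auto simp: indicator_def p simp del: One_nat_def)
  finally show ?thesis .
qed

text \<open>The factorised law of the first \<open>m\<close> values is a hypothesis, so that the
  lemma serves inside the induction proving that law, with \<open>S = {..<s}\<close>, and again
  after it, with \<open>S = {..u}\<close>.\<close>

lemma prob_new_maximum:
  assumes m: "Suc m \<le> N" and S: "S \<in> sets borel" "\<And>s t. t \<in> S \<Longrightarrow> s \<le> t \<Longrightarrow> s \<in> S"
    and p: "\<And>s. prob {\<omega> \<in> space M. num_maxima (\<lambda>i. Y i \<omega>) m = j \<and> (\<forall>i\<in>{1..m}. Y i \<omega> < s)} =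
      D.F s ^ m * c"
  shows "prob {\<omega> \<in> space M. num_maxima (\<lambda>i. Y i \<omega>) m = j
      \<and> (\<forall>i\<in>{1..m}. Y i \<omega> < Y (Suc m) \<omega>) \<and> Y (Suc m) \<omega> \<in> S} =
    measure D S ^ Suc m / Suc m * c"
proof -
  have "(\<integral>u. indicator S u * (D.F u ^ m * c) \<partial>D) = (\<integral>u. indicator S u * D.F u ^ m * c \<partial>D)"
    by (simp only: mult.assoc)
  also have "\<dots> = measure D S ^ Suc m / Suc m * c"
    using D.integral_F_power[OF S] by simp
  finally show ?thesis
    using prob_maxima_next[OF m S(1) _ p, of "\<lambda>u. u"] by simp
qed

text \<open>The product form expresses that the number of maxima is independent of the largest
  value. In the induction, \<open>?A - ?E j\<close> keeps the count at \<open>j\<close> and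
  \<open>?E (j - 1)\<close> raises it to \<open>j\<close>; their weights \<open>m / (m + 1)\<close>
  and \<open>1 / (m + 1)\<close> reproduce \<open>maxima_prob_Suc\<close>.\<close>

lemma prob_num_maxima:
  "m \<le> N \<Longrightarrow> prob {\<omega> \<in> space M. num_maxima (\<lambda>i. Y i \<omega>) m = j \<and> (\<forall>i\<in>{1..m}. Y i \<omega> < s)} =
    D.F s ^ m * maxima_prob m j"
proof (induction m arbitrary: j s)
  case 0
  then show ?case
    by (simp add: maxima_prob_0 prob_space)
next
  case (Suc m)
  let ?k = "\<lambda>\<omega>. num_maxima (\<lambda>i. Y i \<omega>) m"
  \<comment> \<open>Only the last value is compared with \<open>s\<close>: as the largest it bounds
    the others, so \<open>?E j\<close> lies in \<open>?A\<close>.\<close>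
  let ?E = "\<lambda>j. {\<omega> \<in> space M. ?k \<omega> = j \<and> (\<forall>i\<in>{1..m}. Y i \<omega> < Y (Suc m) \<omega>) \<and> Y (Suc m) \<omega> \<in> {..<s}}"
  let ?A = "{\<omega> \<in> space M. ?k \<omega> = j \<and> (\<forall>i\<in>{1..m}. Y i \<omega> < s) \<and> Y (Suc m) \<omega> < s}"
  have IH: "prob {\<omega> \<in> space M. ?k \<omega> = j \<and> (\<forall>i\<in>{1..m}. Y i \<omega> < s)} = D.F s ^ m * maxima_prob m j" for j s
    using Suc by simp
  have k[measurable]: "?k \<in> measurable M (count_space UNIV)"
    using Suc.prems by (intro measurable_num_maxima measurable_Y) auto
  have Ym[measurable]: "Y (Suc m) \<in> borel_measurable M"
    using Suc.prems by (rule measurable_Y)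
  have [measurable]: "Measurable.pred M (\<lambda>\<omega>. \<forall>i\<in>{1..m}. Y i \<omega> < Y (Suc m) \<omega>)"
    "Measurable.pred M (\<lambda>\<omega>. \<forall>i\<in>{1..m}. Y i \<omega> < s)"
    using Suc.prems
    by (intro pred_intros_finite borel_measurable_pred_less measurable_Y borel_measurable_const Ym; simp)+
  have events: "?A \<in> events" "?E j \<in> events" for j
    by measurable
  have E: "prob (?E j) = D.F s ^ Suc m / Suc m * maxima_prob m j" for j
    using prob_new_maximum[OF Suc.prems _ _ IH, of "{..<s}" j] by (simp add: D.F_def)
  have A: "prob ?A = D.F s ^ Suc m * maxima_prob m j"
    using prob_maxima_next[OF Suc.prems _ _ IH, of "{..<s}" "\<lambda>_. s" j] by (simp add: D.F_def)
  have diff: "prob (?A - ?E j) = D.F s ^ Suc m * (real m * maxima_prob m j / Suc m)"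
  proof -
    have "prob (?A - ?E j) = prob ?A - prob (?E j)"
      by (rule finite_measure_Diff[OF events]) (auto intro: less_trans)
    also have "\<dots> = D.F s ^ Suc m * (real m * maxima_prob m j / Suc m)"
      unfolding A E by (simp add: field_simps)
    finally show ?thesis .
  qed
  show ?case
  proof (cases j)
    case 0
    have eq: "{\<omega> \<in> space M. num_maxima (\<lambda>i. Y i \<omega>) (Suc m) = j \<and> (\<forall>i\<in>{1..Suc m}. Y i \<omega> < s)} = ?A - ?E j"
      using 0 by (auto simp: atLeastAtMostSuc_conv)
    show ?thesis
      unfolding eq diff by (simp add: maxima_prob_Suc 0 del: of_nat_Suc power_Suc)
  next
    case (Suc i)
    have "{\<omega> \<in> space M. num_maxima (\<lambda>i. Y i \<omega>) (Suc m) = j \<and> (\<forall>i\<in>{1..Suc m}. Y i \<omega> < s)} = (?A - ?E j) \<union> ?E i"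
      using Suc by (auto simp: atLeastAtMostSuc_conv intro: less_trans)
    moreover have "prob ((?A - ?E j) \<union> ?E i) = prob (?A - ?E j) + prob (?E i)"
      using Suc by (intro finite_measure_Union sets.Diff events) auto
    ultimately show ?thesis
      unfolding diff E maxima_prob_Suc
      by (simp add: Suc add_divide_distrib distrib_left del: of_nat_Suc power_Suc)
  qed
qed

text \<open>Given \<open>Y 0 = u\<close>, the set \<open>S = {..u}\<close> in
  \<open>prob_new_maximum\<close> contributes \<open>F u ^ Suc m / Suc m\<close>, and integrating
  over \<open>u\<close> gives the second factor. These are the chances that \<open>Y (Suc m)\<close>
  is the largest of \<open>m + 1\<close> values and \<open>Y 0\<close> the largest of
  \<open>m + 2\<close>.\<close>

lemma prob_new_low_maximum:
  assumes m: "Suc m \<le> N"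
  shows "prob {\<omega> \<in> space M. num_low_maxima (\<lambda>i. Y i \<omega>) m = j
      \<and> (\<forall>i\<in>{1..m}. Y i \<omega> < Y (Suc m) \<omega>) \<and> Y (Suc m) \<omega> \<le> Y 0 \<omega>} =
    maxima_prob m j / (real (Suc m) * real (Suc (Suc m)))"
proof -
  let ?Q = "\<lambda>u \<omega>. num_maxima (\<lambda>i. Y i \<omega>) m = j \<and> (\<forall>i\<in>{1..m}. Y i \<omega> < Y (Suc m) \<omega>) \<and> Y (Suc m) \<omega> \<in> {..u}"
  have low: "num_low_maxima (\<lambda>i. Y i \<omega>) m = num_maxima (\<lambda>i. Y i \<omega>) m"
    if "\<forall>i\<in>{1..m}. Y i \<omega> < Y (Suc m) \<omega>" "Y (Suc m) \<omega> \<le> Y 0 \<omega>" for \<omega>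
    using that by (intro num_low_maxima_eq) (meson less_imp_le less_le_trans)
  have "prob {\<omega> \<in> space M. num_low_maxima (\<lambda>i. Y i \<omega>) m = j
      \<and> (\<forall>i\<in>{1..m}. Y i \<omega> < Y (Suc m) \<omega>) \<and> Y (Suc m) \<omega> \<le> Y 0 \<omega>} = prob {\<omega> \<in> space M. ?Q (Y 0 \<omega>) \<omega>}"
    using low by (intro arg_cong[where f=prob]) (auto simp del: One_nat_def)
  also have "\<dots> = (\<integral>u. prob {\<omega> \<in> space M. ?Q u \<omega>} \<partial>D)"
  proof (rule prob_eq_integral[where J = "{1..Suc m}"])
    let ?P = "\<lambda>u v. num_maxima v m = j \<and> (\<forall>i\<in>{1..m}. v i < v (Suc m)) \<and> v (Suc m) \<le> u"
    show "?P u (\<lambda>j\<in>{1..Suc m}. Y j \<omega>) \<longleftrightarrow> ?Q u \<omega>" for u \<omega>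
    proof -
      have "num_maxima (\<lambda>j\<in>{1..Suc m}. Y j \<omega>) m = num_maxima (\<lambda>i. Y i \<omega>) m"
        by (rule num_maxima_cong) auto
      then show ?thesis by simp
    qed
    let ?N = "borel \<Otimes>\<^sub>M PiM {1..Suc m} (\<lambda>_. borel) :: (real \<times> (nat \<Rightarrow> real)) measure"
    have comp: "(\<lambda>z. snd z i) \<in> borel_measurable ?N" if "i \<in> {1..Suc m}" for i
      using that by measurable
    have [measurable]: "(\<lambda>z. snd z (Suc m)) \<in> borel_measurable ?N"
      by (rule comp) simp
    have [measurable]: "Measurable.pred ?N (\<lambda>z. \<forall>i\<in>{1..m}. snd z i < snd z (Suc m))"
      by (intro pred_intros_finite borel_measurable_pred_less comp) auto
    have [measurable]: "(\<lambda>z. num_maxima (\<lambda>i. snd z i) m) \<in> measurable ?N (count_space UNIV)"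
      by (rule measurable_num_maxima) (rule comp, simp)
    show "Measurable.pred ?N (\<lambda>z. ?P (fst z) (snd z))"
      by measurable
  qed (use m in auto)
  also have "\<dots> = (\<integral>u. D.F u ^ Suc m * (maxima_prob m j / Suc m) \<partial>D)"
    by (intro Bochner_Integration.integral_cong refl, subst prob_new_maximum[OF m _ _ prob_num_maxima])
       (use m in \<open>auto simp: D.prob_atMost\<close>)
  also have "\<dots> = maxima_prob m j / (real (Suc m) * real (Suc (Suc m)))"
    using D.integral_F_power[of UNIV "Suc m"] D.prob_space by (simp del: power_Suc of_nat_Suc)
  finally show ?thesis .
qed

text \<open>The count starts at zero, and each step moves the probability of \<open>?E k\<close>
  from the value \<open>k\<close> to \<open>k + 1\<close>; the two sums collect what has flowed in
  and out.\<close>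

lemma prob_num_low_maxima:
  "n \<le> N \<Longrightarrow> prob {\<omega> \<in> space M. num_low_maxima (\<lambda>i. Y i \<omega>) n = k} =
    of_bool (k = 0) + (if k = 0 then 0 else new_max_sum n (k - 1)) - new_max_sum n k"
proof (induction n arbitrary: k)
  case 0
  then show ?case
    by (simp add: new_max_sum_def prob_space)
next
  case (Suc n)
  let ?b = "\<lambda>\<omega>. num_low_maxima (\<lambda>i. Y i \<omega>) n"
  let ?E = "\<lambda>k. {\<omega> \<in> space M. ?b \<omega> = k \<and> (\<forall>i\<in>{1..n}. Y i \<omega> < Y (Suc n) \<omega>) \<and> Y (Suc n) \<omega> \<le> Y 0 \<omega>}"
  let ?A = "{\<omega> \<in> space M. ?b \<omega> = k}"
  have [measurable]: "?b \<in> measurable M (count_space UNIV)"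
    using Suc.prems by (intro measurable_num_low_maxima measurable_Y) auto
  have Yn[measurable]: "Y (Suc n) \<in> borel_measurable M" "Y 0 \<in> borel_measurable M"
    using Suc.prems by (auto intro: measurable_Y)
  have [measurable]: "Measurable.pred M (\<lambda>\<omega>. \<forall>i\<in>{1..n}. Y i \<omega> < Y (Suc n) \<omega>)"
    using Suc.prems
    by (intro pred_intros_finite borel_measurable_pred_less measurable_Y Yn) auto
  have events: "?A \<in> events" "?E k \<in> events" for k
    by measurable
  have E: "prob (?E k) = maxima_prob n k / (real (Suc n) * real (Suc (Suc n)))" for k
    using Suc.prems by (rule prob_new_low_maximum)
  have A: "prob ?A = of_bool (k = 0) + (if k = 0 then 0 else new_max_sum n (k - 1)) - new_max_sum n k"
    using Suc by simp
  have diff: "prob (?A - ?E k) = prob ?A - prob (?E k)"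
    by (rule finite_measure_Diff[OF events]) auto
  show ?case
  proof (cases k)
    case 0
    have "{\<omega> \<in> space M. num_low_maxima (\<lambda>i. Y i \<omega>) (Suc n) = k} = ?A - ?E k"
      using 0 by auto
    then show ?thesis
      using diff A E[of k] 0 by (simp add: new_max_sum_def del: of_nat_Suc)
  next
    case (Suc i)
    have "{\<omega> \<in> space M. num_low_maxima (\<lambda>i. Y i \<omega>) (Suc n) = k} = (?A - ?E k) \<union> ?E i"
      using Suc by auto
    moreover have "prob ((?A - ?E k) \<union> ?E i) = prob (?A - ?E k) + prob (?E i)"
      using Suc by (intro finite_measure_Union sets.Diff events) auto
    ultimately show ?thesis
      using diff A E[of k] E[of i] Suc by (simp add: new_max_sum_def del: of_nat_Suc)
  qed
qed

end

subsection \<open>Broken records\<close>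

lemma num_low_maxima_eq_card:
  "num_low_maxima y m = card {i \<in> {1..m}. (\<forall>j\<in>{1..<i}. y j < y i) \<and> y i \<le> y 0}"
proof (induction m)
  case (Suc m)
  let ?R = "\<lambda>i. (\<forall>j\<in>{1..<i}. y j < y i) \<and> y i \<le> y 0"
  have "{i \<in> {1..Suc m}. ?R i} = (if ?R (Suc m) then insert (Suc m) {i \<in> {1..m}. ?R i} else {i \<in> {1..m}. ?R i})"
    by (auto simp: le_Suc_eq)
  then show ?case
    using Suc by (simp add: atLeastLessThanSuc_atLeastAtMost)
qed simp

text \<open>An index \<open>a < n\<close> is a record at time \<open>n - 1\<close> iff
  \<open>x a\<close> strictly exceeds all later values before time \<open>n\<close>, and it is then
  broken iff \<open>x a \<le> x n\<close>. The substitution \<open>i = n - a\<close> turns this into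
  the condition for a low maximum.\<close>

lemma num_broken_eq_num_low_maxima:
  "num_broken x n = num_low_maxima (\<lambda>i. x (n - i)) n"
proof (cases "n = 0")
  case True
  then show ?thesis by (simp add: num_broken_def broken_records_def)
next
  case False
  define I where "I = {i \<in> {1..n}. (\<forall>j\<in>{1..<i}. x (n - j) < x (n - i)) \<and> x (n - i) \<le> x n}"
  have "broken_records x n = {(a, x a) | a. a < n \<and> (\<forall>b. a < b \<and> b < n \<longrightarrow> x b < x a) \<and> x a \<le> x n}"
  proof (intro set_eqI iffI)
    fix z assume z: "z \<in> broken_records x n"
    then obtain a where a: "z = (a, x a)" "a < n"
      and cur: "\<forall>c\<le>n - 1. c \<noteq> a \<longrightarrow> \<not> (a \<le> c \<and> x a \<le> x c)"
      using False by (auto simp: broken_records_def current_records_def prec_def)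
    have rec: "x c < x a" if "c < n" "c \<noteq> a" "a \<le> c" for c
    proof -
      have "c \<le> n - 1"
        using that by linarith
      then show ?thesis
        using cur that by auto
    qed
    have "(a, x a) \<notin> current_records x n"
      using z a by (simp add: broken_records_def)
    then obtain c where "c \<le> n" "c \<noteq> a" "a \<le> c" "x a \<le> x c"
      using a(2) by (auto simp: current_records_def prec_def)
    \<comment> \<open>A record at time \<open>n - 1\<close> is not dominated by any other index
      below \<open>n\<close>, so the dominating index \<open>c\<close> must be
      \<open>n\<close>.\<close>
    then have "x a \<le> x n"
      using rec[of c] by (cases "c = n") auto
    then show "z \<in> {(a, x a) | a. a < n \<and> (\<forall>b. a < b \<and> b < n \<longrightarrow> x b < x a) \<and> x a \<le> x n}"
      using a rec by auto
  next
    fix z assume "z \<in> {(a, x a) | a. a < n \<and> (\<forall>b. a < b \<and> b < n \<longrightarrow> x b < x a) \<and> x a \<le> x n}"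
    then obtain a where a: "z = (a, x a)" "a < n" "\<And>b. a < b \<Longrightarrow> b < n \<Longrightarrow> x b < x a" "x a \<le> x n"
      by auto
    have "\<not> (a \<le> b \<and> x a \<le> x b)" if "b \<le> n - 1" "b \<noteq> a" for b
    proof -
      have "b < n"
        using that False by linarith
      then show ?thesis
        using a(3)[of b] that by auto
    qed
    then have "z \<in> current_records x (n - 1)"
      using a(1,2) by (auto simp: current_records_def prec_def)
    moreover have "z \<notin> current_records x n"
      using a(1,2,4) by (auto simp: current_records_def prec_def)
    ultimately show "z \<in> broken_records x n"
      by (simp add: broken_records_def)
  qed
  also have "\<dots> = (\<lambda>i. (n - i, x (n - i))) ` I"
  proof (intro set_eqI iffI)
    fix z assume "z \<in> {(a, x a) | a. a < n \<and> (\<forall>b. a < b \<and> b < n \<longrightarrow> x b < x a) \<and> x a \<le> x n}"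
    then obtain a where a: "z = (a, x a)" "a < n" "\<And>b. a < b \<Longrightarrow> b < n \<Longrightarrow> x b < x a" "x a \<le> x n"
      by auto
    then have "n - a \<in> I"
      by (auto simp: I_def)
    then show "z \<in> (\<lambda>i. (n - i, x (n - i))) ` I"
      by (rule rev_image_eqI) (use a in simp)
  next
    fix z assume "z \<in> (\<lambda>i. (n - i, x (n - i))) ` I"
    then obtain i where i: "z = (n - i, x (n - i))" "i \<in> I" by auto
    have "x b < x (n - i)" if "n - i < b" "b < n" for b
    proof -
      have "n - b \<in> {1..<i}"
        using that by auto
      with i(2) have "x (n - (n - b)) < x (n - i)"
        unfolding I_def by blast
      then show ?thesis
        using that by simp
    qed
    then show "z \<in> {(a, x a) | a. a < n \<and> (\<forall>b. a < b \<and> b < n \<longrightarrow> x b < x a) \<and> x a \<le> x n}"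
      using i by (auto simp: I_def)
  qed
  finally have "num_broken x n = card ((\<lambda>i. (n - i, x (n - i))) ` I)"
    by (simp add: num_broken_def)
  also have "\<dots> = card I"
    by (intro card_image) (auto simp: inj_on_def I_def)
  finally show ?thesis
    by (simp add: num_low_maxima_eq_card I_def)
qed

lemma (in prob_space) indep_vars_reindex_inj:
  assumes "indep_vars M' X I" "inj_on f J" "f ` J \<subseteq> I"
  shows "indep_vars (\<lambda>j. M' (f j)) (\<lambda>j. X (f j)) J"
  unfolding indep_vars_def2
proof (intro conjI ballI indep_setsI)
  let ?F = "\<lambda>i. {X i -` A \<inter> space M | A. A \<in> sets (M' i)}"
  have rv: "random_variable (M' i) (X i)" if "i \<in> I" for i
    using assms(1) that by (auto simp: indep_vars_def2)
  have ind: "indep_sets ?F I"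
    using assms(1) by (auto simp: indep_vars_def2)
  show "random_variable (M' (f j)) (X (f j))" if "j \<in> J" for j
    using that assms(3) by (intro rv) auto
  then show "?F (f j) \<subseteq> events" if "j \<in> J" for j
    using that by (auto intro: measurable_sets)
  fix A K assume K: "K \<noteq> {}" "K \<subseteq> J" "finite K" and A: "\<forall>j\<in>K. A j \<in> ?F (f j)"
  \<comment> \<open>The events are transported to the image of \<open>K\<close>, where the
    independence of \<open>X\<close> applies.\<close>
  define B where "B = (\<lambda>i. A (the_inv_into K f i))"
  have inj: "inj_on f K"
    using assms(2) K(2) by (rule inj_on_subset)
  then have B: "B (f j) = A j" if "j \<in> K" for j
    using that by (simp add: B_def the_inv_into_f_f)
  have "prob (\<Inter>i\<in>f ` K. B i) = (\<Prod>i\<in>f ` K. prob (B i))"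
  proof (rule indep_setsD[OF ind])
    show "\<forall>i\<in>f ` K. B i \<in> ?F i"
      using A B by auto
  qed (use K assms(3) in auto)
  then show "prob (\<Inter>j\<in>K. A j) = (\<Prod>j\<in>K. prob (A j))"
    using B by (simp add: prod.reindex[OF inj])
qed

theorem mainTheorem1:
  fixes M :: "'a measure" and X :: "nat \<Rightarrow> 'a \<Rightarrow> real" and k :: nat
  assumes "prob_space M"
    and "prob_space.indep_vars M (\<lambda>_. borel) X UNIV"
    and "\<And>i. distr M borel (X i) = distr M borel (X 0)"
    and "continuous_on UNIV (cdf (distr M borel (X 0)))"
  shows "(\<lambda>n. measure M {\<omega> \<in> space M. num_broken (\<lambda>i. X i \<omega>) n = k})
           \<longlonglongrightarrow> 1 / 2 ^ (k + 1)"
proof -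
  interpret prob_space M by fact
  let ?D = "distr M borel (X 0)"
  have "X 0 \<in> borel_measurable M"
    using assms(2) by (auto simp: indep_vars_def)
  then interpret D: real_distribution ?D
    by (rule real_distribution_distr)
  \<comment> \<open>Continuity of the distribution function at \<open>x\<close> is equivalent to
    \<open>x\<close> having mass zero.\<close>
  have "D.prob {x} = 0" for x
    using assms(4) by (simp add: D.isCont_cdf[symmetric] continuous_on_eq_continuous_at)
  then interpret D: atomless_distribution ?D
    by unfold_locales
  have prob_eq: "prob {\<omega> \<in> space M. num_broken (\<lambda>i. X i \<omega>) n = k} =
      of_bool (k = 0) + (if k = 0 then 0 else new_max_sum n (k - 1)) - new_max_sum n k" for n
  proof -
    \<comment> \<open>The reversal depends on \<open>n\<close>, so each time needs its own instance;
      \<open>i \<mapsto> n - i\<close> is injective on \<open>{..n}\<close>.\<close>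
    interpret iid_atomless M ?D "\<lambda>i. X (n - i)" n
    proof
      show "indep_vars (\<lambda>_. borel) (\<lambda>i. X (n - i)) {..n}"
        by (rule indep_vars_reindex_inj[OF assms(2)]) (auto simp: inj_on_def)
      show "distr M borel (X (n - i)) = ?D" for i
        by (rule assms(3))
    qed
    show ?thesis
      unfolding num_broken_eq_num_low_maxima by (rule prob_num_low_maxima) simp
  qed
  show ?thesis
  proof (cases k)
    case 0
    have "(\<lambda>n. 1 - new_max_sum n 0) \<longlonglongrightarrow> 1 - 1 / 2 ^ Suc 0"
      by (intro tendsto_intros tendsto_new_max_sum)
    then show ?thesis
      unfolding prob_eq by (simp add: 0)
  next
    case (Suc i)
    have "(\<lambda>n. new_max_sum n i - new_max_sum n (Suc i)) \<longlonglongrightarrow> 1 / 2 ^ Suc i - 1 / 2 ^ Suc (Suc i)"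
      by (intro tendsto_intros tendsto_new_max_sum)
    then show ?thesis
      unfolding prob_eq by (simp add: Suc)
  qed
qed

end
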